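(* Let $k$ be a field, let $R=k[x,y]$ or $R=k[[x,y]]$, and let $I=\langle x^{a_i}y^{b_i}\rangle_{i=0}^r\subset R$ be an $\langle x,y\rangle$-primary ideal generated by monomials of the same degree $d$, where the nonnegative integer exponents satisfy $a_i<a_{i+1}$ and $b_i>b_{i+1}$ for all $i$; that is, $a_0=b_r=0$ and $b_i=d-a_i$ for all $i$. Let $S=\langle a_i\rangle_{i=0}^r$ and $T=\langle b_i\rangle_{i=0}^r$ be the associated numerical semigroups. Then the Ratliff-Rush ideal associated to $I$ is $$\tilde I=I_S\cap I_T .$$
   Context: For nonnegative integers $c_0,\dots,c_r$, the numerical semigroup $\langle c_0,\dots,c_r\rangle$ is the set of all sums $\sum_i\lambda_ic_i$ with $\lambda_i\in\mathbb Z_{\ge 0}$ (the gcd of the generators need not be $1$). For a regular ideal $I$ (one containing a nonzerodivisor) in a Noetherian ring $R$, the ideals $(I^{l+1}:I^l)$, $l\ge 1$, increase with $l$, and the Ratliff-Rush ideal associated to $I$ is $\tilde I=\bigcup_{l\ge 1}(I^{l+1}:I^l)$. Define the ideals $I_S=\langle x^sy^{d-s} : s\in S,\ s\le d\rangle$ and $I_T=\langle x^{d-t}y^t : t\in T,\ t\le d\rangle$ of $R$. *)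

theory Defs
  imports Main "HOL-Computational_Algebra.Computational_Algebra"
begin

(* A commutative ring viewed as a module over itself: ideal.subspace I says that I is an ideal,
   and ideal.span G is the ideal generated by G. *)
interpretation ideal: module "(*) :: 'a::comm_ring_1 \<Rightarrow> 'a \<Rightarrow> 'a"
  by standard (simp_all add: algebra_simps)

definition ideal_mult :: "'a::comm_ring_1 set \<Rightarrow> 'a set \<Rightarrow> 'a set" where
  "ideal_mult I J = ideal.span {f * g | f g. f \<in> I \<and> g \<in> J}"

primrec ideal_pow :: "'a::comm_ring_1 set \<Rightarrow> nat \<Rightarrow> 'a set" where
  "ideal_pow I 0 = UNIV"
| "ideal_pow I (Suc n) = ideal_mult I (ideal_pow I n)"

definition ideal_colon :: "'a::comm_ring_1 set \<Rightarrow> 'a set \<Rightarrow> 'a set" where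
  "ideal_colon I J = {f. \<forall>g\<in>J. f * g \<in> I}"

definition ratliff_rush :: "'a::comm_ring_1 set \<Rightarrow> 'a set" where
  "ratliff_rush I = (\<Union>l\<in>{1..}. ideal_colon (ideal_pow I (l + 1)) (ideal_pow I l))"

definition ideal_radical :: "'a::comm_ring_1 set \<Rightarrow> 'a set" where
  "ideal_radical I = {f. \<exists>n. f ^ n \<in> I}"

definition primary_ideal :: "'a::comm_ring_1 set \<Rightarrow> bool" where
  "primary_ideal Q \<longleftrightarrow> ideal.subspace Q \<and> Q \<noteq> UNIV \<and>
     (\<forall>f g. f * g \<in> Q \<longrightarrow> f \<in> Q \<or> (\<exists>n. g ^ n \<in> Q))"

definition primary_to :: "'a::comm_ring_1 set \<Rightarrow> 'a set \<Rightarrow> bool" where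
  "primary_to P Q \<longleftrightarrow> primary_ideal Q \<and> ideal_radical Q = P"

definition num_semigroup :: "(nat \<Rightarrow> nat) \<Rightarrow> nat \<Rightarrow> nat set" where
  "num_semigroup c r = {n. \<exists>m :: nat \<Rightarrow> nat. n = (\<Sum>i\<le>r. m i * c i)}"

(* The next three ideals live in any commutative ring with two chosen elements x and y;
   they are used for the two variables of k[x,y] and of k[[x,y]]. *)
definition monomial_ideal ::
    "'a::comm_ring_1 \<Rightarrow> 'a \<Rightarrow> (nat \<Rightarrow> nat) \<Rightarrow> (nat \<Rightarrow> nat) \<Rightarrow> nat \<Rightarrow> 'a set" where
  "monomial_ideal x y a b r = ideal.span {x ^ a i * y ^ b i | i. i \<le> r}"

definition ideal_S :: "'a::comm_ring_1 \<Rightarrow> 'a \<Rightarrow> nat \<Rightarrow> nat set \<Rightarrow> 'a set" where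
  "ideal_S x y d S = ideal.span {x ^ s * y ^ (d - s) | s. s \<in> S \<and> s \<le> d}"

definition ideal_T :: "'a::comm_ring_1 \<Rightarrow> 'a \<Rightarrow> nat \<Rightarrow> nat set \<Rightarrow> 'a set" where
  "ideal_T x y d T = ideal.span {x ^ (d - t) * y ^ t | t. t \<in> T \<and> t \<le> d}"

(* k[x,y] is modelled as k[x][y], and k[[x,y]] as k[[x]][[y]]: the outer variable is y. *)
definition poly_x :: "'k::field poly poly" where "poly_x = [:[:0, 1:]:]"
definition poly_y :: "'k::field poly poly" where "poly_y = [:0, 1:]"
definition fps_x :: "'k::field fps fps" where "fps_x = fps_const fps_X"
definition fps_y :: "'k::field fps fps" where "fps_y = fps_X"

end

theory Submission
  imports Defs
begin

text \<open>
  Membership in a finitely generated monomial ideal can be read off the support, so everything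
  reduces to exponents. Multiplying by \<open>y ^ (l * d)\<close> and by \<open>x ^ (l * d)\<close>, both in the \<open>l\<close>-th
  power of \<open>I\<close>, shows that the Ratliff-Rush ideal lies in both \<open>I_S\<close> and \<open>I_T\<close>.
  Conversely, for large \<open>l\<close> every product of \<open>l\<close> generators contains some generator
  \<open>x ^ a i * y ^ b i\<close> at least \<open>d * d\<close> times; since its \<open>d\<close>-th power equals
  \<open>(x ^ d) ^ a i * (y ^ d) ^ b i\<close>, the product can be rewritten so as to contain \<open>x ^ d\<close> or \<open>y ^ d\<close>
  at least \<open>d\<close> times. Elements of \<open>S\<close> and \<open>T\<close> that are at most \<open>d\<close> are sums of at most \<open>d\<close> nonzero
  generators, so \<open>(x ^ d) ^ d\<close> times a generator of \<open>I_T\<close>, and \<open>(y ^ d) ^ d\<close> times a generator of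
  \<open>I_S\<close>, is a product of \<open>d + 1\<close> generators of \<open>I\<close>.
\<close>

text \<open>This rule, inherited from modules, reassociates products to the left and so loops together with \<open>mult.assoc\<close>.\<close>

declare ideal.scale_scale [simp del]

section \<open>Exponents of products of generators\<close>

definition exps :: "nat \<Rightarrow> (nat \<Rightarrow> nat) \<Rightarrow> (nat \<Rightarrow> nat) \<Rightarrow> nat \<Rightarrow> (nat \<times> nat) set" where
  "exps r a b l =
     {(\<Sum>i\<le>r. m i * a i, \<Sum>i\<le>r. m i * b i) | m :: nat \<Rightarrow> nat. (\<Sum>i\<le>r. m i) = l}"

lemma sum_delta_mult:
  fixes c :: "nat \<Rightarrow> nat"
  shows "k \<le> r \<Longrightarrow> (\<Sum>i\<le>r. (if i = k then n else 0) * c i) = n * c k"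
  by (simp add: if_distrib[of "\<lambda>z. z * _"] cong: if_cong)

lemma exps_0: "exps r a b 0 = {(0, 0)}"
  by (auto simp: exps_def intro!: exI[of _ "\<lambda>_. 0"])

text \<open>Splitting off one factor matches the recursion of \<open>ideal_pow\<close>; a positive
  total multiplicity leaves some \<open>m k\<close> to decrease.\<close>

lemma exps_Suc:
  "exps r a b (Suc l) = (\<lambda>(i, u, v). (a i + u, b i + v)) ` ({..r} \<times> exps r a b l)"
proof (intro equalityI subsetI)
  fix p assume "p \<in> exps r a b (Suc l)"
  then obtain m where m: "(\<Sum>i\<le>r. m i) = Suc l"
    and p: "p = (\<Sum>i\<le>r. m i * a i, \<Sum>i\<le>r. m i * b i)"
    by (auto simp: exps_def)
  obtain k where k: "k \<le> r" "m k > 0"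
    using m by (metis atMost_iff gr0I nat.distinct(1) sum.neutral)
  define m' where "m' i = m i - (if i = k then 1 else 0)" for i
  have split: "m i = m' i + (if i = k then 1 else 0)" for i
    using k by (auto simp: m'_def)
  have "(\<Sum>i\<le>r. m' i) = l"
    using m k unfolding split by (simp add: sum.distrib)
  moreover have "(\<Sum>i\<le>r. m i * c i) = c k + (\<Sum>i\<le>r. m' i * c i)" for c
    unfolding split add_mult_distrib sum.distrib sum_delta_mult[OF k(1)] by simp
  ultimately show "p \<in> (\<lambda>(i, u, v). (a i + u, b i + v)) ` ({..r} \<times> exps r a b l)"
    using k p by (force simp: exps_def)
next
  fix p assume "p \<in> (\<lambda>(i, u, v). (a i + u, b i + v)) ` ({..r} \<times> exps r a b l)"
  then obtain k m where k: "k \<le> r" and m: "(\<Sum>i\<le>r. m i) = l"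
    and p: "p = (a k + (\<Sum>i\<le>r. m i * a i), b k + (\<Sum>i\<le>r. m i * b i))"
    by (auto simp: exps_def)
  define m' where "m' i = m i + (if i = k then 1 else 0)" for i
  have "(\<Sum>i\<le>r. m' i) = Suc l"
    using m k by (simp add: m'_def sum.distrib)
  moreover have "(\<Sum>i\<le>r. m' i * c i) = c k + (\<Sum>i\<le>r. m i * c i)" for c
    unfolding m'_def add_mult_distrib sum.distrib sum_delta_mult[OF k] by simp
  ultimately show "p \<in> exps r a b (Suc l)"
    using p unfolding exps_def by (auto intro!: exI[of _ m'])
qed

lemma finite_exps: "finite (exps r a b l)"
  by (induction l) (simp_all add: exps_0 exps_Suc)

lemma exps_replicate: "k \<le> r \<Longrightarrow> (l * a k, l * b k) \<in> exps r a b l"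
  unfolding exps_def
  by (auto intro!: exI[of _ "\<lambda>i. if i = k then l else 0"] simp: sum_delta_mult)

lemma exps_degree:
  assumes "\<And>i. i \<le> r \<Longrightarrow> a i + b i = (d::nat)" "(u, v) \<in> exps r a b l"
  shows "u + v = l * d"
proof -
  obtain m where m: "(\<Sum>i\<le>r. m i) = l" "u = (\<Sum>i\<le>r. m i * a i)" "v = (\<Sum>i\<le>r. m i * b i)"
    using assms(2) by (auto simp: exps_def)
  have "u + v = (\<Sum>i\<le>r. m i * (a i + b i))"
    by (simp add: m sum.distrib algebra_simps)
  also have "\<dots> = (\<Sum>i\<le>r. m i * d)"
    by (rule sum.cong) (simp_all add: assms(1))
  finally show ?thesis
    by (simp add: m(1) sum_distrib_right[symmetric])
qed

section \<open>Numerical semigroups and exchange of summands\<close>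

lemma generator_in_num_semigroup:
  assumes "k \<le> r"
  shows "c k \<in> num_semigroup c r"
  unfolding num_semigroup_def
  using sum_delta_mult[OF assms, of 1 c]
  by (intro CollectI exI[of _ "\<lambda>i. if i = k then 1 else 0"]) simp

text \<open>The coefficient of the zero generator is free, which allows padding to exactly
  \<open>Suc d\<close> summands.\<close>

lemma num_semigroup_padded:
  assumes "s \<in> num_semigroup c r" "s \<le> d" "z \<le> r" "c z = 0"
    and "\<And>i. i \<le> r \<Longrightarrow> i \<noteq> z \<Longrightarrow> 1 \<le> c i"
  obtains p :: "nat \<Rightarrow> nat" where "(\<Sum>i\<le>r. p i) = Suc d" "(\<Sum>i\<le>r. p i * c i) = s"
proof -
  obtain m where m: "s = (\<Sum>i\<le>r. m i * c i)"
    using assms(1) by (auto simp: num_semigroup_def)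
  define q where "q i = (if i = z then 0 else m i)" for i
  have qs: "(\<Sum>i\<le>r. q i * c i) = s"
    unfolding m by (rule sum.cong) (auto simp: q_def assms(4))
  \<comment> \<open>With the zero generator dropped, each counted summand is at least 1, so there
    are at most \<open>s \<le> d\<close> of them.\<close>
  have "(\<Sum>i\<le>r. q i) \<le> (\<Sum>i\<le>r. q i * c i)"
    using assms(5) by (intro sum_mono) (auto simp: q_def)
  then have le: "(\<Sum>i\<le>r. q i) \<le> d"
    using qs assms(2) by simp
  define e where "e = Suc d - (\<Sum>i\<le>r. q i)"
  define p where "p i = q i + (if i = z then e else 0)" for i
  have "(\<Sum>i\<le>r. p i) = Suc d"
    using le assms(3) by (simp add: p_def sum.distrib e_def)
  moreover have "(\<Sum>i\<le>r. p i * c i) = s"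
    unfolding p_def add_mult_distrib sum.distrib sum_delta_mult[OF assms(3)]
    by (simp add: qs assms(4))
  ultimately show ?thesis
    using that by blast
qed

text \<open>The \<open>d\<close> removed copies of generator \<open>z\<close> contribute nothing to
  the weighted sum, while the padded representation of \<open>s\<close> puts back
  \<open>Suc d\<close> generators: the count grows by one and the sum by \<open>s\<close>.\<close>

lemma exchange_zero_generator:
  fixes m :: "nat \<Rightarrow> nat"
  assumes "s \<in> num_semigroup c r" "s \<le> d" "z \<le> r" "c z = 0"
    and "\<And>i. i \<le> r \<Longrightarrow> i \<noteq> z \<Longrightarrow> 1 \<le> c i"
    and "d \<le> m z"
  obtains m' :: "nat \<Rightarrow> nat" where
    "(\<Sum>i\<le>r. m' i) = Suc (\<Sum>i\<le>r. m i)" "(\<Sum>i\<le>r. m' i * c i) = s + (\<Sum>i\<le>r. m i * c i)"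
proof -
  obtain p where p: "(\<Sum>i\<le>r. p i) = Suc d" "(\<Sum>i\<le>r. p i * c i) = s"
    using num_semigroup_padded[OF assms(1-5)] by blast
  define m' where "m' i = m i + p i - (if i = z then d else 0)" for i
  have eq: "m' i + (if i = z then d else 0) = m i + p i" for i
    using assms(6) by (auto simp: m'_def)
  have "(\<Sum>i\<le>r. m' i) + d = (\<Sum>i\<le>r. m' i + (if i = z then d else 0))"
    using assms(3) by (simp add: sum.distrib)
  also have "\<dots> = (\<Sum>i\<le>r. m i) + Suc d"
    unfolding eq by (simp add: sum.distrib p)
  finally have "(\<Sum>i\<le>r. m' i) = Suc (\<Sum>i\<le>r. m i)"
    by simp
  moreover have "(\<Sum>i\<le>r. m' i * c i) = s + (\<Sum>i\<le>r. m i * c i)"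
  proof -
    have "(\<Sum>i\<le>r. (m' i + (if i = z then d else 0)) * c i) = (\<Sum>i\<le>r. m' i * c i)"
      unfolding add_mult_distrib sum.distrib sum_delta_mult[OF assms(3)] by (simp add: assms(4))
    moreover have "(\<Sum>i\<le>r. (m' i + (if i = z then d else 0)) * c i) = s + (\<Sum>i\<le>r. m i * c i)"
      unfolding eq add_mult_distrib sum.distrib p by simp
    ultimately show ?thesis by simp
  qed
  ultimately show ?thesis
    using that by blast
qed

text \<open>The zero exponents at the ends make \<open>y ^ d\<close> (index \<open>0\<close>) and
  \<open>x ^ d\<close> (index \<open>r\<close>) generators; positivity elsewhere bounds the number
  of nonzero summands in elements of either semigroup.\<close>

locale exponent_sequences =
  fixes a b :: "nat \<Rightarrow> nat" and r d :: nat
  assumes degree: "\<And>i. i \<le> r \<Longrightarrow> a i + b i = d"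
    and a_0: "a 0 = 0" and b_r: "b r = 0"
    and a_pos: "\<And>i. i \<le> r \<Longrightarrow> i \<noteq> 0 \<Longrightarrow> 1 \<le> a i"
    and b_pos: "\<And>i. i \<le> r \<Longrightarrow> i \<noteq> r \<Longrightarrow> 1 \<le> b i"
begin

lemma b_0: "b 0 = d" and a_r: "a r = d"
  using degree[of 0] degree[of r] a_0 b_r by auto

lemma many_extreme_generators:
  assumes "(u, v) \<in> exps r a b l" "l \<ge> Suc (Suc r * (d * d))"
  obtains m where "(\<Sum>i\<le>r. m i) = l" "(\<Sum>i\<le>r. m i * a i) = u" "(\<Sum>i\<le>r. m i * b i) = v"
    "d \<le> m 0 \<or> d \<le> m r"
proof -
  obtain m where m: "(\<Sum>i\<le>r. m i) = l" "u = (\<Sum>i\<le>r. m i * a i)" "v = (\<Sum>i\<le>r. m i * b i)"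
    using assms(1) by (auto simp: exps_def)
  \<comment> \<open>Pigeonhole: multiplicities of at most \<open>d * d\<close> at all
    \<open>Suc r\<close> indices would give a total below \<open>l\<close>.\<close>
  have "\<exists>k\<le>r. d * d \<le> m k"
  proof (rule ccontr)
    assume "\<not> ?thesis"
    then have "\<And>i. i \<le> r \<Longrightarrow> m i \<le> d * d"
      by (meson nat_le_linear)
    then have "(\<Sum>i\<le>r. m i) \<le> (\<Sum>i\<le>r. d * d)"
      by (intro sum_mono) simp
    then show False
      using assms(2) m(1) by simp
  qed
  then obtain k where k: "k \<le> r" "d * d \<le> m k" by blast
  \<comment> \<open>Trades \<open>d * d\<close> copies of generator \<open>k\<close> for
    \<open>d * b k\<close> copies of \<open>y ^ d\<close> and \<open>d * a k\<close> copies of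
    \<open>x ^ d\<close>. The count is unchanged because \<open>a k + b k = d\<close>.\<close>
  define m' where "m' i = m i - (if i = k then d * d else 0)
      + ((if i = 0 then d * b k else 0) + (if i = r then d * a k else 0))" for i
  have eq: "m' i + (if i = k then d * d else 0)
      = m i + ((if i = 0 then d * b k else 0) + (if i = r then d * a k else 0))" for i
    using k by (auto simp: m'_def)
  have dd: "d * b k + d * a k = d * d"
    using degree[OF k(1)] by (metis add.commute distrib_left)
  \<comment> \<open>Taking \<open>c\<close> to be constantly 1, then \<open>a\<close>, then
    \<open>b\<close> shows that the count and both exponents are preserved.\<close>
  have weighted: "(\<Sum>i\<le>r. m' i * c i) + d * d * c k
      = (\<Sum>i\<le>r. m i * c i) + (d * b k * c 0 + d * a k * c r)" for c
  proof -
    have "(\<Sum>i\<le>r. m' i * c i) + d * d * c k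
        = (\<Sum>i\<le>r. (m' i + (if i = k then d * d else 0)) * c i)"
      unfolding add_mult_distrib sum.distrib sum_delta_mult[OF k(1)] ..
    also have "\<dots> = (\<Sum>i\<le>r. m i * c i) + (d * b k * c 0 + d * a k * c r)"
      unfolding eq add_mult_distrib sum.distrib sum_delta_mult[OF le0] sum_delta_mult[OF order_refl] ..
    finally show ?thesis .
  qed
  have "(\<Sum>i\<le>r. m' i) = l"
    using weighted[of "\<lambda>_. 1"] dd m(1) by simp
  moreover have "(\<Sum>i\<le>r. m' i * a i) = u"
    using weighted[of a] by (simp add: a_0 a_r m)
  moreover have "(\<Sum>i\<le>r. m' i * b i) = v"
    using weighted[of b] by (simp add: b_0 b_r m)
  \<comment> \<open>If \<open>b k = 0\<close>, all \<open>d * d\<close> copies land on index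
    \<open>r\<close>; otherwise at least \<open>d\<close> land on index \<open>0\<close>.\<close>
  moreover have "d \<le> m' 0 \<or> d \<le> m' r"
  proof (cases "b k = 0")
    case True
    then have "a k = d" using degree[OF k(1)] by simp
    then have "d * d \<le> m' r" by (simp add: m'_def)
    then show ?thesis by (metis le_square order_trans)
  next
    case False
    then have "d \<le> d * b k" by simp
    also have "\<dots> \<le> m' 0" by (simp add: m'_def)
    finally show ?thesis ..
  qed
  ultimately show ?thesis
    using that by blast
qed

text \<open>The pair \<open>(i, j)\<close> lies above a generator of \<open>I_S\<close> and above
  one of \<open>I_T\<close>. Abundant copies of \<open>y ^ d\<close> absorb the former, abundant
  copies of \<open>x ^ d\<close> the latter; the exponent not tracked by the exchange is forced by
  the degree.\<close>

lemma exps_absorb: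
  assumes uv: "(u, v) \<in> exps r a b l" and l: "l \<ge> Suc (Suc r * (d * d))"
    and s: "s \<in> num_semigroup a r" "s \<le> d" "s \<le> i" "d - s \<le> j"
    and t: "t \<in> num_semigroup b r" "t \<le> d" "d - t \<le> i" "t \<le> j"
  shows "\<exists>(u', v') \<in> exps r a b (Suc l). u' \<le> u + i \<and> v' \<le> v + j"
proof -
  obtain m where m: "(\<Sum>i\<le>r. m i) = l" "(\<Sum>i\<le>r. m i * a i) = u" "(\<Sum>i\<le>r. m i * b i) = v"
    and or: "d \<le> m 0 \<or> d \<le> m r"
    using many_extreme_generators[OF uv l] by metis
  have deg: "u + v = l * d"
    using exps_degree[OF degree uv] .
  from or show ?thesis
  proof
    assume "d \<le> m 0"
    then obtain m' where m': "(\<Sum>i\<le>r. m' i) = Suc l" "(\<Sum>i\<le>r. m' i * a i) = s + u"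
      using exchange_zero_generator[of s a r d 0 m] s a_0 a_pos m by auto
    define v' where "v' = (\<Sum>i\<le>r. m' i * b i)"
    have mem: "(s + u, v') \<in> exps r a b (Suc l)"
      unfolding exps_def v'_def using m' by (auto intro!: exI[of _ m'])
    have "s + u + v' = Suc l * d"
      using exps_degree[OF degree mem] .
    \<comment> \<open>Comparing degrees gives \<open>v' = v + (d - s)\<close>.\<close>
    then have "v' \<le> v + j" using deg s by simp
    then show ?thesis using mem s by (intro bexI[OF _ mem]) simp
  next
    assume "d \<le> m r"
    then obtain m' where m': "(\<Sum>i\<le>r. m' i) = Suc l" "(\<Sum>i\<le>r. m' i * b i) = t + v"
      using exchange_zero_generator[of t b r d r m] t b_r b_pos m by auto
    define u' where "u' = (\<Sum>i\<le>r. m' i * a i)"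
    have mem: "(u', t + v) \<in> exps r a b (Suc l)"
      unfolding exps_def u'_def using m' by (auto intro!: exI[of _ m'])
    have "u' + (t + v) = Suc l * d"
      using exps_degree[OF degree mem] .
    then have "u' \<le> u + i" using deg t by simp
    then show ?thesis using mem t by (intro bexI[OF _ mem]) simp
  qed
qed

lemma exps_fst_in_num_semigroup: "(u, v) \<in> exps r a b l \<Longrightarrow> u \<in> num_semigroup a r"
  and exps_snd_in_num_semigroup: "(u, v) \<in> exps r a b l \<Longrightarrow> v \<in> num_semigroup b r"
  by (auto simp: exps_def num_semigroup_def)

lemma d_in_num_semigroup: "d \<in> num_semigroup a r" "d \<in> num_semigroup b r"
  using generator_in_num_semigroup[of r r a] generator_in_num_semigroup[of 0 r b] a_r b_0 by auto

end

section \<open>Products of ideals\<close>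

lemma ideal_mult_span:
  "ideal_mult (ideal.span A) (ideal.span B) = ideal.span {f * g | f g. f \<in> A \<and> g \<in> B}"
  (is "_ = ideal.span ?C")
proof (rule antisym)
  have "f * g \<in> ideal.span ?C" if f: "f \<in> ideal.span A" and g: "g \<in> ideal.span B" for f g
  proof -
    have sub: "ideal.subspace {f. f * h \<in> ideal.span ?C}" for h
      by (auto simp: ideal.subspace_def ideal.span_zero distrib_right ideal.span_add
          mult.assoc ideal.span_scale)
    \<comment> \<open>First \<open>f\<close> ranges over its span with \<open>g\<close> a generator,
      then \<open>g\<close> over its span with \<open>f\<close> fixed.\<close>
    have "f * g \<in> ideal.span ?C" if "g \<in> B" for g
    proof -
      have "ideal.span A \<subseteq> {f. f * g \<in> ideal.span ?C}"
        using that by (intro ideal.span_minimal sub) (auto intro!: ideal.span_base)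
      then show ?thesis using f by auto
    qed
    then have "ideal.span B \<subseteq> {g. g * f \<in> ideal.span ?C}"
      by (intro ideal.span_minimal sub) (auto simp: mult.commute)
    then show ?thesis using g by (auto simp: mult.commute)
  qed
  then show "ideal_mult (ideal.span A) (ideal.span B) \<subseteq> ideal.span ?C"
    unfolding ideal_mult_def by (intro ideal.span_minimal) auto
  show "ideal.span ?C \<subseteq> ideal_mult (ideal.span A) (ideal.span B)"
    unfolding ideal_mult_def by (rule ideal.span_mono) (blast intro: ideal.span_base)
qed

lemma ideal_colon_span:
  assumes "ideal.subspace K"
  shows "f \<in> ideal_colon K (ideal.span B) \<longleftrightarrow> (\<forall>g\<in>B. f * g \<in> K)"
proof
  assume "\<forall>g\<in>B. f * g \<in> K"
  moreover have "ideal.subspace {g. f * g \<in> K}"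
    using assms by (simp add: ideal.subspace_def distrib_left mult.left_commute[of f])
  ultimately have "ideal.span B \<subseteq> {g. f * g \<in> K}"
    by (intro ideal.span_minimal) auto
  then show "f \<in> ideal_colon K (ideal.span B)"
    by (auto simp: ideal_colon_def)
qed (auto simp: ideal_colon_def intro: ideal.span_base)

section \<open>Monomial ideals in a ring with coefficients\<close>

text \<open>The common properties of \<open>k[x, y]\<close> and \<open>k[[x, y]]\<close> on which the argument rests;
  \<open>cf f i j\<close> is the coefficient of \<open>x ^ i * y ^ j\<close>.\<close>

locale bivariate_coeffs =
  fixes x y :: "'r::comm_ring_1" and cf :: "'r \<Rightarrow> nat \<Rightarrow> nat \<Rightarrow> 'k::field"
  assumes cf_0 [simp]: "cf 0 i j = 0"
    and cf_1: "cf 1 0 0 \<noteq> 0"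
    and cf_add: "cf (f + g) i j = cf f i j + cf g i j"
    and cf_x_mult: "cf (x * f) i j = (if i = 0 then 0 else cf f (i - 1) j)"
    and cf_y_mult: "cf (y * f) i j = (if j = 0 then 0 else cf f i (j - 1))"
    and cf_mult_nonzero: "cf (f * g) i j \<noteq> 0 \<Longrightarrow> \<exists>i'\<le>i. \<exists>j'\<le>j. cf g i' j' \<noteq> 0"
    and cf_eq_0: "(\<And>i j. cf f i j = 0) \<Longrightarrow> f = 0"
    and cf_shift: "\<exists>g. \<forall>i j. cf g i j = cf f (i + u) (j + v)"
begin

section \<open>Support criterion for monomial ideals\<close>

lemma cf_diff: "cf (f - g) i j = cf f i j - cf g i j"
  using cf_add[of "f - g" g i j] by simp

lemma cf_x_power_mult: "cf (x ^ u * f) i j = (if i < u then 0 else cf f (i - u) j)"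
  by (induction u arbitrary: i) (auto simp: mult.assoc cf_x_mult)

lemma cf_y_power_mult: "cf (y ^ v * f) i j = (if j < v then 0 else cf f i (j - v))"
  by (induction v arbitrary: j) (auto simp: mult.assoc cf_y_mult)

lemma cf_monomial_mult:
  "cf (x ^ u * y ^ v * f) i j = (if u \<le> i \<and> v \<le> j then cf f (i - u) (j - v) else 0)"
  by (simp add: mult.assoc cf_x_power_mult cf_y_power_mult)

lemma supported_in_span:
  assumes "finite G" "\<And>i j. cf f i j \<noteq> 0 \<Longrightarrow> \<exists>(u, v) \<in> G. u \<le> i \<and> v \<le> j"
  shows "f \<in> ideal.span ((\<lambda>(u, v). x ^ u * y ^ v) ` G)"
  using assms
proof (induction G arbitrary: f rule: finite_induct)
  case empty
  then have "f = 0" by (intro cf_eq_0) auto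
  then show ?case by (simp add: ideal.span_zero)
next
  case (insert p G)
  obtain u v where p: "p = (u, v)" by fastforce
  \<comment> \<open>\<open>g\<close> is the part of \<open>f\<close> divisible by
    \<open>x ^ u * y ^ v\<close>, divided by that monomial. The remainder \<open>h\<close> keeps the
    other terms, which lie above pairs in \<open>G\<close>.\<close>
  obtain g where g: "\<And>i j. cf g i j = cf f (i + u) (j + v)"
    using cf_shift by blast
  define h where "h = f - x ^ u * y ^ v * g"
  have h: "cf h i j = (if u \<le> i \<and> v \<le> j then 0 else cf f i j)" for i j
    by (simp add: h_def cf_diff cf_monomial_mult g)
  have "h \<in> ideal.span ((\<lambda>(u, v). x ^ u * y ^ v) ` G)"
  proof (rule insert.IH)
    fix i j assume "cf h i j \<noteq> 0"
    then have "\<not> (u \<le> i \<and> v \<le> j)" "cf f i j \<noteq> 0"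
      unfolding h by (auto split: if_splits)
    then show "\<exists>(u, v)\<in>G. u \<le> i \<and> v \<le> j"
      using insert.prems[of i j] p by auto
  qed
  then have "h \<in> ideal.span ((\<lambda>(u, v). x ^ u * y ^ v) ` insert p G)"
    by (rule subsetD[OF ideal.span_mono, rotated]) auto
  moreover have "g * (x ^ u * y ^ v) \<in> ideal.span ((\<lambda>(u, v). x ^ u * y ^ v) ` insert p G)"
    using p by (intro ideal.span_scale ideal.span_base) auto
  ultimately have "h + g * (x ^ u * y ^ v) \<in> ideal.span ((\<lambda>(u, v). x ^ u * y ^ v) ` insert p G)"
    by (rule ideal.span_add)
  then show ?case by (simp add: h_def mult.commute)
qed

text \<open>The elements whose support lies above \<open>G\<close> form an ideal: by
  \<open>cf_mult_nonzero\<close>, each term of \<open>c * f\<close> lies above a term of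
  \<open>f\<close>.\<close>

lemma in_span_supported:
  assumes "f \<in> ideal.span ((\<lambda>(u, v). x ^ u * y ^ v) ` G)" "cf f i j \<noteq> 0"
  shows "\<exists>(u, v) \<in> G. u \<le> i \<and> v \<le> j"
proof -
  let ?K = "{f. \<forall>i j. cf f i j \<noteq> 0 \<longrightarrow> (\<exists>(u, v) \<in> G. u \<le> i \<and> v \<le> j)}"
  have "ideal.subspace ?K"
    unfolding ideal.subspace_def
  proof (intro conjI ballI allI)
    fix f g assume fg: "f \<in> ?K" "g \<in> ?K"
    show "f + g \<in> ?K"
    proof (intro CollectI allI impI)
      fix i j assume "cf (f + g) i j \<noteq> 0"
      then have "cf f i j \<noteq> 0 \<or> cf g i j \<noteq> 0" by (auto simp: cf_add)
      then show "\<exists>(u, v) \<in> G. u \<le> i \<and> v \<le> j" using fg by blast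
    qed
  next
    fix c f assume f: "f \<in> ?K"
    show "c * f \<in> ?K"
    proof (intro CollectI allI impI)
      fix i j assume "cf (c * f) i j \<noteq> 0"
      then obtain i' j' where "i' \<le> i" "j' \<le> j" "cf f i' j' \<noteq> 0"
        using cf_mult_nonzero by blast
      moreover from this obtain u v where "(u, v) \<in> G" "u \<le> i'" "v \<le> j'"
        using f by blast
      ultimately show "\<exists>(u, v) \<in> G. u \<le> i \<and> v \<le> j"
        by (intro bexI[of _ "(u, v)"]) auto
    qed
  qed simp
  moreover have "(\<lambda>(u, v). x ^ u * y ^ v) ` G \<subseteq> ?K"
  proof clarify
    fix u v i j assume "(u, v) \<in> G" "cf (x ^ u * y ^ v) i j \<noteq> 0"
    then show "\<exists>(u, v) \<in> G. u \<le> i \<and> v \<le> j"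
      using cf_monomial_mult[of u v 1 i j] by (auto split: if_splits)
  qed
  ultimately have "ideal.span ((\<lambda>(u, v). x ^ u * y ^ v) ` G) \<subseteq> ?K"
    by (intro ideal.span_minimal)
  then show ?thesis using assms by blast
qed

lemma in_monomial_span_iff:
  assumes "finite G"
  shows "f \<in> ideal.span ((\<lambda>(u, v). x ^ u * y ^ v) ` G) \<longleftrightarrow>
    (\<forall>i j. cf f i j \<noteq> 0 \<longrightarrow> (\<exists>(u, v) \<in> G. u \<le> i \<and> v \<le> j))"
  using supported_in_span[OF assms] in_span_supported by blast

lemma ideal_pow_monomial_ideal:
  "ideal_pow (monomial_ideal x y a b r) l =
     ideal.span ((\<lambda>(u, v). x ^ u * y ^ v) ` exps r a b l)"
proof (induction l)
  case 0
  have "f * 1 \<in> ideal.span {1}" for f :: 'r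
    by (intro ideal.span_scale ideal.span_base) simp
  then show ?case by (auto simp: exps_0)
next
  case (Suc l)
  have "{f * g | f g. f \<in> {x ^ a i * y ^ b i | i. i \<le> r}
      \<and> g \<in> (\<lambda>(u, v). x ^ u * y ^ v) ` exps r a b l}
    = (\<lambda>(u, v). x ^ u * y ^ v) ` exps r a b (Suc l)" (is "?L = ?R")
  proof (intro equalityI subsetI)
    fix f assume "f \<in> ?L"
    then obtain i u v where "i \<le> r" "(u, v) \<in> exps r a b l"
      "f = x ^ a i * y ^ b i * (x ^ u * y ^ v)" by auto
    then show "f \<in> ?R"
      unfolding exps_Suc image_image
      by (intro image_eqI[of _ _ "(i, u, v)"]) (auto simp: power_add algebra_simps)
  next
    fix f assume "f \<in> ?R"
    then obtain i u v where "i \<le> r" "(u, v) \<in> exps r a b l"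
      "f = x ^ (a i + u) * y ^ (b i + v)" by (auto simp: exps_Suc)
    moreover from this have "f = x ^ a i * y ^ b i * (x ^ u * y ^ v)"
      by (simp add: power_add algebra_simps)
    ultimately show "f \<in> ?L" by force
  qed
  then show ?case
    unfolding ideal_pow.simps Suc.IH unfolding monomial_ideal_def ideal_mult_span by simp
qed

text \<open>It suffices to test the monomials spanning the \<open>l\<close>-th power, and
  multiplying by \<open>x ^ u * y ^ v\<close> shifts the support by \<open>(u, v)\<close>.\<close>

lemma in_colon_pow_iff:
  "f \<in> ideal_colon (ideal_pow (monomial_ideal x y a b r) (l + 1))
        (ideal_pow (monomial_ideal x y a b r) l) \<longleftrightarrow>
   (\<forall>(u, v) \<in> exps r a b l. \<forall>i j. cf f i j \<noteq> 0 \<longrightarrow>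
      (\<exists>(u', v') \<in> exps r a b (Suc l). u' \<le> u + i \<and> v' \<le> v + j))"
proof -
  let ?E = "exps r a b"
  have "f \<in> ideal_colon (ideal_pow (monomial_ideal x y a b r) (l + 1))
        (ideal_pow (monomial_ideal x y a b r) l) \<longleftrightarrow>
      (\<forall>(u, v) \<in> ?E l. \<forall>i j. cf (x ^ u * y ^ v * f) i j \<noteq> 0 \<longrightarrow>
        (\<exists>(u', v') \<in> ?E (Suc l). u' \<le> i \<and> v' \<le> j))"
    unfolding ideal_pow_monomial_ideal ideal_colon_span[OF ideal.subspace_span]
      Suc_eq_plus1[symmetric]
    by (auto simp: in_monomial_span_iff[OF finite_exps] mult.commute[of f])
  also have "\<dots> \<longleftrightarrow> (\<forall>(u, v) \<in> ?E l. \<forall>i j. cf f i j \<noteq> 0 \<longrightarrow>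
      (\<exists>(u', v') \<in> ?E (Suc l). u' \<le> u + i \<and> v' \<le> v + j))"
  proof -
    have "(\<forall>i j. cf (x ^ u * y ^ v * f) i j \<noteq> 0 \<longrightarrow> P i j) \<longleftrightarrow>
        (\<forall>i j. cf f i j \<noteq> 0 \<longrightarrow> P (u + i) (v + j))" for u v P
    proof (intro iffI allI impI)
      fix i j assume "\<forall>i j. cf (x ^ u * y ^ v * f) i j \<noteq> 0 \<longrightarrow> P i j" "cf f i j \<noteq> 0"
      then show "P (u + i) (v + j)"
        by (simp add: cf_monomial_mult)
    next
      fix i j assume P: "\<forall>i j. cf f i j \<noteq> 0 \<longrightarrow> P (u + i) (v + j)"
        and "cf (x ^ u * y ^ v * f) i j \<noteq> 0"
      then have "u \<le> i" "v \<le> j" "cf f (i - u) (j - v) \<noteq> 0"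
        by (auto simp: cf_monomial_mult split: if_splits)
      then show "P i j"
        using P[rule_format, of "i - u" "j - v"] by simp
    qed
    then show ?thesis by (simp only:)
  qed
  finally show ?thesis .
qed

section \<open>Comparison with \<open>I_S\<close> and \<open>I_T\<close>\<close>

lemma in_ideal_S_iff:
  "f \<in> ideal_S x y d S \<longleftrightarrow>
     (\<forall>i j. cf f i j \<noteq> 0 \<longrightarrow> (\<exists>s\<in>S. s \<le> d \<and> s \<le> i \<and> d - s \<le> j))"
proof -
  have "{x ^ s * y ^ (d - s) | s. s \<in> S \<and> s \<le> d}
      = (\<lambda>(u, v). x ^ u * y ^ v) ` (\<lambda>s. (s, d - s)) ` {s \<in> S. s \<le> d}" by auto
  then show ?thesis
    unfolding ideal_S_def by (simp add: in_monomial_span_iff) blast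
qed

lemma in_ideal_T_iff:
  "f \<in> ideal_T x y d T \<longleftrightarrow>
     (\<forall>i j. cf f i j \<noteq> 0 \<longrightarrow> (\<exists>t\<in>T. t \<le> d \<and> d - t \<le> i \<and> t \<le> j))"
proof -
  have "{x ^ (d - t) * y ^ t | t. t \<in> T \<and> t \<le> d}
      = (\<lambda>(u, v). x ^ u * y ^ v) ` (\<lambda>t. (d - t, t)) ` {t \<in> T. t \<le> d}" by auto
  then show ?thesis
    unfolding ideal_T_def by (simp add: in_monomial_span_iff) blast
qed

lemma ratliff_rush_monomial_ideal:
  assumes "exponent_sequences a b r d"
  shows "ratliff_rush (monomial_ideal x y a b r) =
    ideal_S x y d (num_semigroup a r) \<inter> ideal_T x y d (num_semigroup b r)"
proof -
  interpret exponent_sequences a b r d by fact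
  show ?thesis
  proof (intro equalityI subsetI)
    fix f assume "f \<in> ratliff_rush (monomial_ideal x y a b r)"
    then obtain l where l: "\<And>u v i j. (u, v) \<in> exps r a b l \<Longrightarrow> cf f i j \<noteq> 0 \<Longrightarrow>
        \<exists>(u', v') \<in> exps r a b (Suc l). u' \<le> u + i \<and> v' \<le> v + j"
      unfolding ratliff_rush_def using in_colon_pow_iff by blast
    have "\<exists>s\<in>num_semigroup a r. s \<le> d \<and> s \<le> i \<and> d - s \<le> j" if "cf f i j \<noteq> 0" for i j
    proof -
      \<comment> \<open>Testing with \<open>y ^ (l * d)\<close> leaves the exponent of
        \<open>x\<close> at \<open>i\<close>, so \<open>u' \<le> i\<close>.\<close>
      have "(0, l * d) \<in> exps r a b l"
        using exps_replicate[of 0 r l a b] by (simp add: a_0 b_0)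
      from l[OF this that] obtain u' v' where uv: "(u', v') \<in> exps r a b (Suc l)"
        "u' \<le> i" "v' \<le> l * d + j" by auto
      have "u' + v' = Suc l * d" using exps_degree[OF degree uv(1)] .
      then have "d - u' \<le> j" using uv by simp
      then show ?thesis
        \<comment> \<open>The witness is \<open>u'\<close> if \<open>u' \<le> d\<close>; otherwise
          \<open>d\<close> itself, which lies in \<open>S\<close> and is at most
          \<open>i\<close>.\<close>
        using uv exps_fst_in_num_semigroup[OF uv(1)] d_in_num_semigroup(1)
        by (cases "u' \<le> d") (auto intro: bexI[of _ d] bexI[of _ u'])
    qed
    moreover have "\<exists>t\<in>num_semigroup b r. t \<le> d \<and> d - t \<le> i \<and> t \<le> j" if "cf f i j \<noteq> 0" for i j
    proof -
      have "(l * d, 0) \<in> exps r a b l"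
        using exps_replicate[of r r l a b] by (simp add: a_r b_r)
      from l[OF this that] obtain u' v' where uv: "(u', v') \<in> exps r a b (Suc l)"
        "u' \<le> l * d + i" "v' \<le> j" by auto
      have "u' + v' = Suc l * d" using exps_degree[OF degree uv(1)] .
      then have "d - v' \<le> i" using uv by simp
      then show ?thesis
        using uv exps_snd_in_num_semigroup[OF uv(1)] d_in_num_semigroup(2)
        by (cases "v' \<le> d") (auto intro: bexI[of _ d] bexI[of _ v'])
    qed
    ultimately show "f \<in> ideal_S x y d (num_semigroup a r) \<inter> ideal_T x y d (num_semigroup b r)"
      by (simp add: in_ideal_S_iff in_ideal_T_iff)
  next
    fix f assume f: "f \<in> ideal_S x y d (num_semigroup a r) \<inter> ideal_T x y d (num_semigroup b r)"
    \<comment> \<open>The threshold of \<open>exps_absorb\<close>, independent of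
      \<open>f\<close>.\<close>
    define l where "l = Suc (Suc r * (d * d))"
    have "f \<in> ideal_colon (ideal_pow (monomial_ideal x y a b r) (l + 1))
        (ideal_pow (monomial_ideal x y a b r) l)"
      unfolding in_colon_pow_iff
    proof clarify
      fix u v i j assume uv: "(u, v) \<in> exps r a b l" and nz: "cf f i j \<noteq> 0"
      obtain s where "s \<in> num_semigroup a r" "s \<le> d" "s \<le> i" "d - s \<le> j"
        using f nz by (auto simp: in_ideal_S_iff)
      moreover obtain t where "t \<in> num_semigroup b r" "t \<le> d" "d - t \<le> i" "t \<le> j"
        using f nz by (auto simp: in_ideal_T_iff)
      ultimately show "\<exists>(u', v') \<in> exps r a b (Suc l). u' \<le> u + i \<and> v' \<le> v + j"
        using exps_absorb[OF uv] l_def by blast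
    qed
    then show "f \<in> ratliff_rush (monomial_ideal x y a b r)"
      unfolding ratliff_rush_def by (rule UN_I[rotated]) (simp add: l_def)
  qed
qed

text \<open>Since the radical contains \<open>x\<close> and \<open>y\<close>, some
  \<open>x ^ m\<close> and \<open>y ^ n\<close> lie in the ideal. A generator below
  \<open>(m, 0)\<close> has no \<open>y\<close>, and one below \<open>(0, n)\<close> has no
  \<open>x\<close>.\<close>

lemma primary_monomial_ideal_pure_powers:
  assumes "primary_to (ideal.span {x, y}) (monomial_ideal x y a b r)"
  shows "\<exists>i\<le>r. a i = 0" "\<exists>i\<le>r. b i = 0"
proof -
  let ?I = "monomial_ideal x y a b r"
  have I: "?I = ideal.span ((\<lambda>(u, v). x ^ u * y ^ v) ` (\<lambda>i. (a i, b i)) ` {..r})"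
    unfolding monomial_ideal_def by (rule arg_cong[of _ _ ideal.span]) auto
  have rad: "ideal.span {x, y} = ideal_radical ?I"
    using assms by (simp add: primary_to_def)
  have "x \<in> ideal_radical ?I" "y \<in> ideal_radical ?I"
    unfolding rad[symmetric] by (auto intro: ideal.span_base)
  then obtain m n where mn: "x ^ m \<in> ?I" "y ^ n \<in> ?I"
    by (auto simp: ideal_radical_def)
  have "cf (x ^ m) m 0 \<noteq> 0" "cf (y ^ n) 0 n \<noteq> 0"
    using cf_x_power_mult[of m 1 m 0] cf_y_power_mult[of n 1 0 n] cf_1 by auto
  then show "\<exists>i\<le>r. a i = 0" "\<exists>i\<le>r. b i = 0"
    using in_span_supported[OF mn(2)[unfolded I], of 0 n]
      in_span_supported[OF mn(1)[unfolded I], of m 0] by auto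
qed

lemma ratliff_rush_primary_monomial_ideal:
  assumes a_less: "\<And>i. i < r \<Longrightarrow> a i < a (Suc i)"
    and b_less: "\<And>i. i < r \<Longrightarrow> b (Suc i) < b i"
    and degree: "\<And>i. i \<le> r \<Longrightarrow> a i + b i = d"
    and primary: "primary_to (ideal.span {x, y}) (monomial_ideal x y a b r)"
  shows "ratliff_rush (monomial_ideal x y a b r) =
    ideal_S x y d (num_semigroup a r) \<inter> ideal_T x y d (num_semigroup b r)"
proof (rule ratliff_rush_monomial_ideal)
  have a_pos: "1 \<le> a i" if "i \<le> r" "i \<noteq> 0" for i
    using a_less[of "i - 1"] that by (cases i) auto
  have b_pos: "1 \<le> b i" if "i \<le> r" "i \<noteq> r" for i
    using b_less[of i] that by auto
  \<comment> \<open>Some index has a zero exponent, and positivity elsewhere forces it to be the end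
    index.\<close>
  have "a 0 = 0" "b r = 0"
    using primary_monomial_ideal_pure_powers[OF primary] a_pos b_pos
    by (metis not_one_le_zero)+
  then show "exponent_sequences a b r d"
    using degree a_pos b_pos by unfold_locales auto
qed

end

section \<open>Polynomials and power series\<close>

lemma bivariate_coeffs_poly:
  "bivariate_coeffs poly_x poly_y (\<lambda>(f :: 'k::field poly poly) i j. coeff (coeff f j) i)"
proof
  fix f g :: "'k poly poly" and i j u v :: nat
  show "coeff (coeff (poly_x * f) j) i = (if i = 0 then 0 else coeff (coeff f j) (i - 1))"
    by (cases i) (simp_all add: poly_x_def)
  show "coeff (coeff (poly_y * f) j) i = (if j = 0 then 0 else coeff (coeff f (j - 1)) i)"
    by (cases j) (simp_all add: poly_y_def)
  show "\<exists>i'\<le>i. \<exists>j'\<le>j. coeff (coeff g j') i' \<noteq> 0" if "coeff (coeff (f * g) j) i \<noteq> 0"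
  proof (rule ccontr)
    assume "\<not> ?thesis"
    then have "coeff (coeff (f * g) j) i = 0"
      by (simp add: coeff_mult coeff_sum)
    with that show False ..
  qed
  show "\<exists>g. \<forall>i j. coeff (coeff g j) i = coeff (coeff f (j + v)) (i + u)"
    \<comment> \<open>The outer shift divides by \<open>y ^ v\<close>, the coefficientwise one by
      \<open>x ^ u\<close>; both discard the terms that are not divisible.\<close>
    by (rule exI[of _ "map_poly (poly_shift u) (poly_shift v f)"])
      (simp add: coeff_map_poly coeff_poly_shift add.commute)
qed (auto simp: poly_eq_iff)

lemma bivariate_coeffs_fps:
  "bivariate_coeffs fps_x fps_y (\<lambda>(f :: 'k::field fps fps) i j. fps_nth (fps_nth f j) i)"
proof
  fix f g :: "'k fps fps" and i j u v :: nat
  show "fps_nth (fps_nth (fps_x * f) j) i = (if i = 0 then 0 else fps_nth (fps_nth f j) (i - 1))"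
    by (simp add: fps_x_def)
  show "fps_nth (fps_nth (fps_y * f) j) i = (if j = 0 then 0 else fps_nth (fps_nth f (j - 1)) i)"
    by (simp add: fps_y_def)
  show "\<exists>i'\<le>i. \<exists>j'\<le>j. fps_nth (fps_nth g j') i' \<noteq> 0" if "fps_nth (fps_nth (f * g) j) i \<noteq> 0"
  proof (rule ccontr)
    assume "\<not> ?thesis"
    then have "fps_nth (fps_nth (f * g) j) i = 0"
      by (simp add: fps_mult_nth fps_sum_nth)
    with that show False ..
  qed
  show "\<exists>g. \<forall>i j. fps_nth (fps_nth g j) i = fps_nth (fps_nth f (j + v)) (i + u)"
    by (rule exI[of _ "Abs_fps (\<lambda>j. fps_shift u (fps_nth f (j + v)))"]) simp
qed (auto simp: fps_eq_iff)

theorem proposition3p7: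
  fixes a b :: "nat \<Rightarrow> nat" and r d :: nat
    and I :: "'k::field poly poly set" and J :: "'k fps fps set"
  assumes a_less: "\<And>i. i < r \<Longrightarrow> a i < a (Suc i)"
    and b_less: "\<And>i. i < r \<Longrightarrow> b (Suc i) < b i"
    and degree_d: "\<And>i. i \<le> r \<Longrightarrow> a i + b i = d"
    and I_def: "I = monomial_ideal poly_x poly_y a b r"
    and J_def: "J = monomial_ideal fps_x fps_y a b r"
  shows "(primary_to (ideal.span {poly_x, poly_y}) I \<longrightarrow>
            ratliff_rush I =
              ideal_S poly_x poly_y d (num_semigroup a r) \<inter>
              ideal_T poly_x poly_y d (num_semigroup b r)) \<and>
         (primary_to (ideal.span {fps_x, fps_y}) J \<longrightarrow>
            ratliff_rush J =
              ideal_S fps_x fps_y d (num_semigroup a r) \<inter>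
              ideal_T fps_x fps_y d (num_semigroup b r))"
  unfolding I_def J_def
  by (intro conjI impI
      bivariate_coeffs.ratliff_rush_primary_monomial_ideal[OF bivariate_coeffs_poly]
      bivariate_coeffs.ratliff_rush_primary_monomial_ideal[OF bivariate_coeffs_fps]
      a_less b_less degree_d)

end
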